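(* Let $\dagger : \mathbb{G}(P)\times \mathcal{L}_0(P) \rightarrow \mathbb{G}(P)$ be a relevant P-graph transformation. Suppose that for every P-graph $G = \langle \Phi, \prec\rangle$ and every propositional formula $\varphi \in \mathcal{L}_0(P)$, the P-graph $\dagger(G,\varphi)= \langle \Phi_\dagger, \prec_\dagger\rangle$ satisfies both of the following conditions. 1. For all $\xi \in \Phi$ there is some $\xi' \in \Phi_\dagger$ such that (a) $\varphi \wedge \xi \equiv \varphi \wedge \xi'$, and (b) for all $\psi' \in \Phi_\dagger$, if $\psi' \prec_\dagger \xi'$ then either $\psi'\equiv \varphi$, or there is $\psi \in \Phi$ such that $\varphi \wedge \psi \equiv \varphi \wedge \psi'$ and $\psi\prec \xi$. 2. For all $\xi \in \Phi_\dagger$, either $\xi \equiv \varphi$, or there is some $\xi' \in \Phi$ such that (a) $\varphi \wedge \xi \equiv \varphi \wedge \xi'$, and (b) for all $\psi' \in \Phi$, if $\psi' \prec \xi'$ then there is $\psi \in \Phi_\dagger$ such that $\varphi \wedge \psi \equiv \varphi \wedge \psi'$ and $\psi\prec_\dagger \xi$. Then $\dagger$ satisfies DP-1; that is, every dynamic operator $\star$ induced by $\dagger$ satisfies DP-1: for every preference model $M=\langle W,\leq,v\rangle$ and every $\varphi\in\mathcal{L}_0(P)$, writing $\star(M,\varphi)=\langle W,\leq_{\star\varphi},v\rangle$, and for all $w,w'\in W$: if $w\vDash\varphi$ and $w'\vDash\varphi$, then $w\leq_{\star\varphi} w'$ if and only if $w\leq w'$.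
   Context: $P$ is a countable set of propositional symbols and $\mathcal{L}_0(P)$ is the set of classical propositional formulas over $P$; $\equiv$ is classical logical equivalence. P-graph: a pair $G=\langle\Phi,\prec\rangle$ with $\Phi\subseteq\mathcal{L}_0(P)$ and $\prec$ a strict partial order on $\Phi$. $\mathbb{G}(P)$ is the set of all P-graphs over $P$. Given a non-empty set $W$ of worlds and a valuation $v:P\to 2^W$, $w\vDash\varphi$ denotes classical satisfaction of $\varphi$ at $w$ (with $w\vDash p$ iff $w\in v(p)$). The relation $\leq_G$ on $W$ is: $w\leq_G w'$ iff for every $\varphi\in\Phi$, either ($w'\vDash\varphi$ implies $w\vDash\varphi$), or there is $\psi\in\Phi$ with $\psi\prec\varphi$, $w\vDash\psi$ and $w'\not\vDash\psi$. Preference model: $M=\langle W,\leq,v\rangle$ with $W$ a non-empty set, $v:P\to 2^W$, and $\leq$ a reflexive transitive relation on $W$ whose strict part $<$ ($w<w'$ iff $w\leq w'$ and not $w'\leq w$) is well-founded. $M$ is induced by a P-graph $G$ iff $\leq\;=\;\leq_G$ (computed with $W$ and $v$). Dynamic operator: a function $\star$ mapping each pair (preference model $\langle W,\leq,v\rangle$, formula $\varphi\in\mathcal{L}_0(P)$) to a preference model $\langle W,\leq_{\star\varphi},v\rangle$ with the same $W$ and $v$. P-graph transformation: any function $\dagger:\mathbb{G}(P)\times\mathcal{L}_0(P)\to\mathbb{G}(P)$. A dynamic operator $\star$ is induced by $\dagger$ if for all preference models $M$, P-graphs $G$ and formulas $\varphi\in\mathcal{L}_0(P)$: if $M$ is induced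 by $G$ then $\star(M,\varphi)$ is induced by $\dagger(G,\varphi)$. $\dagger$ is relevant if some dynamic operator is induced by it. $\dagger$ satisfies a postulate if $\dagger$ is relevant and every dynamic operator induced by $\dagger$ satisfies the postulate.
   Formalization: DP-1 is proved only for preference models induced by some P-graph, not for every preference model; for all models the claim fails, since an induced operator is arbitrary on models induced by no P-graph (e.g. for the identity transformation). *)

theory Defs
  imports "HOL-Library.Countable_Set"
begin

datatype (symbols: 'p) form =
    Atom 'p
  | Falsum
  | Neg "'p form"
  | And "'p form" "'p form"
  | Or "'p form" "'p form"
  | Imp "'p form" "'p form"

definition formulas :: "'p set \<Rightarrow> 'p form set" where
  "formulas P = {\<phi>. symbols \<phi> \<subseteq> P}"

primrec eval :: "('p \<Rightarrow> bool) \<Rightarrow> 'p form \<Rightarrow> bool" where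
  "eval \<beta> (Atom p) \<longleftrightarrow> \<beta> p"
| "eval \<beta> Falsum \<longleftrightarrow> False"
| "eval \<beta> (Neg \<phi>) \<longleftrightarrow> \<not> eval \<beta> \<phi>"
| "eval \<beta> (And \<phi> \<psi>) \<longleftrightarrow> eval \<beta> \<phi> \<and> eval \<beta> \<psi>"
| "eval \<beta> (Or \<phi> \<psi>) \<longleftrightarrow> eval \<beta> \<phi> \<or> eval \<beta> \<psi>"
| "eval \<beta> (Imp \<phi> \<psi>) \<longleftrightarrow> (eval \<beta> \<phi> \<longrightarrow> eval \<beta> \<psi>)"

definition form_equiv :: "'p form \<Rightarrow> 'p form \<Rightarrow> bool" (infix "\<simeq>" 50) where
  "\<phi> \<simeq> \<psi> \<longleftrightarrow> (\<forall>\<beta>. eval \<beta> \<phi> = eval \<beta> \<psi>)"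

definition holds :: "('p \<Rightarrow> 'w set) \<Rightarrow> 'w \<Rightarrow> 'p form \<Rightarrow> bool" where
  "holds v w \<phi> \<longleftrightarrow> eval (\<lambda>p. w \<in> v p) \<phi>"

type_synonym 'p pgraph = "'p form set \<times> 'p form rel"

definition pgraphs :: "'p set \<Rightarrow> 'p pgraph set" where
  "pgraphs P = {(\<Phi>, prec). \<Phi> \<subseteq> formulas P \<and> prec \<subseteq> \<Phi> \<times> \<Phi> \<and> irrefl prec \<and> trans prec}"

fun graph_order :: "'p pgraph \<Rightarrow> 'w set \<Rightarrow> ('p \<Rightarrow> 'w set) \<Rightarrow> 'w rel" where
  "graph_order (\<Phi>, prec) W v =
    {(w, w') \<in> W \<times> W. \<forall>\<phi>\<in>\<Phi>.
       (holds v w' \<phi> \<longrightarrow> holds v w \<phi>) \<or>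
       (\<exists>\<psi>\<in>\<Phi>. (\<psi>, \<phi>) \<in> prec \<and> holds v w \<psi> \<and> \<not> holds v w' \<psi>)}"

type_synonym ('p, 'w) model = "'w set \<times> 'w rel \<times> ('p \<Rightarrow> 'w set)"

text \<open>
  Valuations are empty outside \<open>P\<close>, so that two models are equal exactly when they
  agree on the worlds, the order and the symbols in \<open>P\<close>.
\<close>

definition pref_models :: "'p set \<Rightarrow> ('p, 'w) model set" where
  "pref_models P = {(W, le, v). W \<noteq> {} \<and> (\<forall>p\<in>P. v p \<subseteq> W) \<and> (\<forall>p. p \<notin> P \<longrightarrow> v p = {}) \<and>
     preorder_on W le \<and> wf {(w, w'). (w, w') \<in> le \<and> (w', w) \<notin> le}}"

fun induced_by :: "('p, 'w) model \<Rightarrow> 'p pgraph \<Rightarrow> bool" where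
  "induced_by (W, le, v) G \<longleftrightarrow> le = graph_order G W v"

type_synonym ('p, 'w) operator = "('p, 'w) model \<Rightarrow> 'p form \<Rightarrow> ('p, 'w) model"

definition dynamic_operator :: "'p set \<Rightarrow> ('p, 'w) operator \<Rightarrow> bool" where
  "dynamic_operator P star \<longleftrightarrow>
    (\<forall>W le v. (W, le, v) \<in> pref_models P \<longrightarrow> (\<forall>\<phi>\<in>formulas P.
       \<exists>le'. star (W, le, v) \<phi> = (W, le', v) \<and> (W, le', v) \<in> pref_models P))"

type_synonym 'p transformation = "'p pgraph \<Rightarrow> 'p form \<Rightarrow> 'p pgraph"

definition pgraph_transformation :: "'p set \<Rightarrow> 'p transformation \<Rightarrow> bool" where
  "pgraph_transformation P dag \<longleftrightarrow>
    (\<forall>G\<in>pgraphs P. \<forall>\<phi>\<in>formulas P. dag G \<phi> \<in> pgraphs P)"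

definition operator_induced_by ::
    "'p set \<Rightarrow> ('p, 'w) operator \<Rightarrow> 'p transformation \<Rightarrow> bool" where
  "operator_induced_by P star dag \<longleftrightarrow>
    (\<forall>M\<in>pref_models P. \<forall>G\<in>pgraphs P. \<forall>\<phi>\<in>formulas P.
       induced_by M G \<longrightarrow> induced_by (star M \<phi>) (dag G \<phi>))"

definition relevant :: "'w itself \<Rightarrow> 'p set \<Rightarrow> 'p transformation \<Rightarrow> bool" where
  "relevant TYPE('w) P dag \<longleftrightarrow>
    (\<exists>star :: ('p, 'w) operator. dynamic_operator P star \<and> operator_induced_by P star dag)"

definition satisfies ::
    "'p set \<Rightarrow> 'p transformation \<Rightarrow> (('p, 'w) operator \<Rightarrow> bool) \<Rightarrow> bool" where
  "satisfies P dag postulate \<longleftrightarrow>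
    relevant TYPE('w) P dag \<and>
    (\<forall>star. dynamic_operator P star \<and> operator_induced_by P star dag \<longrightarrow> postulate star)"

definition graph_models :: "'p set \<Rightarrow> ('p, 'w) model set" where
  "graph_models P = {M \<in> pref_models P. \<exists>G\<in>pgraphs P. induced_by M G}"

definition DP1_on :: "'p set \<Rightarrow> ('p, 'w) model set \<Rightarrow> ('p, 'w) operator \<Rightarrow> bool" where
  "DP1_on P \<M> star \<longleftrightarrow>
    (\<forall>W le v \<phi> le'. (W, le, v) \<in> \<M> \<and> \<phi> \<in> formulas P \<and> star (W, le, v) \<phi> = (W, le', v) \<longrightarrow>
       (\<forall>w\<in>W. \<forall>w'\<in>W. holds v w \<phi> \<and> holds v w' \<phi> \<longrightarrow> ((w, w') \<in> le' \<longleftrightarrow> (w, w') \<in> le)))"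

text \<open>
  The class of models is a parameter of DP-1 because a model whose order separates two worlds
  satisfying the same formulas is induced by no P-graph, and being induced by a transformation
  says nothing about what an operator does there. So DP-1 over all of \<^term>\<open>pref_models P\<close> fails
  even for the identity transformation, over any \<open>P\<close>, as soon as there are two worlds;
  \<^term>\<open>graph_models P\<close> is the class on which a transformation determines its operators.
\<close>

lemma identity_violates_unrestricted_DP1:
  fixes a b :: 'w and P :: "'p set"
  assumes "a \<noteq> b"
  shows "relevant TYPE('w) P (\<lambda>G \<phi>. G)"
    and "\<not> satisfies P (\<lambda>G \<phi>. G) (DP1_on P (pref_models P) :: ('p, 'w) operator \<Rightarrow> bool)"
proof -
  show "relevant TYPE('w) P (\<lambda>G \<phi>. G)"
    unfolding relevant_def
    by (rule exI[of _ "\<lambda>M \<phi>. M"]) (auto simp: dynamic_operator_def operator_induced_by_def)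
next
  define W where "W = {a, b}"
  define v where "v = (\<lambda>p. if p \<in> P then W else {})"
  define le where "le = {(a, a), (b, b), (a, b)}"
  define star :: "('p, 'w) operator" where
    "star = (\<lambda>M \<phi>. if M = (W, le, v) then (W, W \<times> W, v) else M)"
  have strict: "{(w, w'). (w, w') \<in> le \<and> (w', w) \<notin> le} = {(a, b)}"
    using assms by (auto simp: le_def)
  have v_W: "W \<noteq> {}" "\<forall>p\<in>P. v p \<subseteq> W" "\<forall>p. p \<notin> P \<longrightarrow> v p = {}"
    by (auto simp: W_def v_def)
  have "wf {(a, b)}"
    using assms by (auto intro!: wf_insert[THEN iffD2])
  then have le: "(W, le, v) \<in> pref_models P"
    unfolding pref_models_def strict mem_Collect_eq prod.case preorder_on_def
    by (simp add: v_W refl_on_def trans_def) (auto simp: W_def le_def)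
  have empty: "{(w, w'). (w, w') \<in> W \<times> W \<and> (w', w) \<notin> W \<times> W} = {}"
    by auto
  then have full: "(W, W \<times> W, v) \<in> pref_models P"
    unfolding pref_models_def empty mem_Collect_eq prod.case preorder_on_def
    by (simp add: v_W refl_on_def trans_def)
  have "holds v a \<phi> = holds v b \<phi>" for \<phi>
    unfolding holds_def
    by (rule arg_cong[of _ _ "\<lambda>\<beta>. eval \<beta> \<phi>"]) (auto simp: v_def W_def)
  then have "(b, a) \<in> graph_order G W v" for G
    by (cases G) (auto simp: W_def)
  moreover have "(b, a) \<notin> le"
    using assms by (auto simp: le_def)
  ultimately have not_induced: "\<not> induced_by (W, le, v) G" for G
    unfolding induced_by.simps by metis
  have "dynamic_operator P star"
    using full by (auto simp: dynamic_operator_def star_def)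
  moreover have "operator_induced_by P star (\<lambda>G \<phi>. G)"
    using not_induced by (auto simp: operator_induced_by_def star_def simp del: induced_by.simps)
  moreover have "\<not> DP1_on P (pref_models P) star"
  proof
    assume *: "DP1_on P (pref_models P) star"
    have "Neg Falsum \<in> formulas P" "star (W, le, v) (Neg Falsum) = (W, W \<times> W, v)"
      by (simp_all add: formulas_def star_def)
    with * le have "\<forall>w\<in>W. \<forall>w'\<in>W. holds v w (Neg Falsum) \<and> holds v w' (Neg Falsum) \<longrightarrow>
        ((w, w') \<in> W \<times> W \<longleftrightarrow> (w, w') \<in> le)"
      unfolding DP1_on_def by blast
    then have "(b, a) \<in> le"
      by (auto simp: holds_def W_def)
    with \<open>(b, a) \<notin> le\<close> show False ..
  qed
  ultimately show "\<not> satisfies P (\<lambda>G \<phi>. G) (DP1_on P (pref_models P) :: ('p, 'w) operator \<Rightarrow> bool)"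
    unfolding satisfies_def by blast
qed

end

theory Submission
  imports Defs
begin

text \<open>
  Two worlds satisfying \<open>\<phi>\<close> cannot be told apart by \<open>\<phi>\<close> itself, and they see no difference
  between formulas that are equivalent given \<open>\<phi>\<close>. The two conditions are, up to this
  identification, a back-and-forth matching between the two P-graphs, and each direction of
  the matching transfers the order restricted to the \<open>\<phi>\<close>-worlds from one graph to the other.
\<close>

lemma holds_cong_given:
  assumes "And \<phi> \<xi> \<simeq> And \<phi> \<xi>'" and "holds v w \<phi>"
  shows "holds v w \<xi> \<longleftrightarrow> holds v w \<xi>'"
  using assms by (auto simp: form_equiv_def holds_def)

text \<open>Each \<xi> is tested through its match \<xi>': either \<xi>' is preserved, and then so
  is \<xi>, or some \<psi>' below \<xi>' compensates, and its counterpart \<psi> below \<xi> has the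
  same truth values at both worlds. The hypothesis \<open>match\<close> has an escape clause for
  formulas equivalent to \<phi> at both levels, so that each of the two conditions of the theorem
  implies an instance of it.\<close>

lemma graph_order_transfer:
  assumes w: "holds v w \<phi>" "holds v w' \<phi>"
    and match: "\<forall>\<xi>\<in>\<Phi>. \<xi> \<simeq> \<phi> \<or> (\<exists>\<xi>'\<in>\<Phi>'. And \<phi> \<xi> \<simeq> And \<phi> \<xi>' \<and>
      (\<forall>\<psi>'\<in>\<Phi>'. (\<psi>', \<xi>') \<in> prec' \<longrightarrow>
        \<psi>' \<simeq> \<phi> \<or> (\<exists>\<psi>\<in>\<Phi>. And \<phi> \<psi> \<simeq> And \<phi> \<psi>' \<and> (\<psi>, \<xi>) \<in> prec)))"
    and le: "(w, w') \<in> graph_order (\<Phi>', prec') W v"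
  shows "(w, w') \<in> graph_order (\<Phi>, prec) W v"
proof -
  have equiv: "holds v w \<chi>" "holds v w' \<chi>" if "\<chi> \<simeq> \<phi>" for \<chi>
    using that w by (auto simp: form_equiv_def holds_def)
  have "(holds v w' \<xi> \<longrightarrow> holds v w \<xi>) \<or>
      (\<exists>\<psi>\<in>\<Phi>. (\<psi>, \<xi>) \<in> prec \<and> holds v w \<psi> \<and> \<not> holds v w' \<psi>)" if "\<xi> \<in> \<Phi>" for \<xi>
  proof (cases "\<xi> \<simeq> \<phi>")
    case True
    \<comment> \<open>Both worlds satisfy \<xi>, so the first disjunct holds.\<close>
    then show ?thesis using equiv by blast
  next
    case False
    with match that obtain \<xi>' where \<xi>': "\<xi>' \<in> \<Phi>'" "And \<phi> \<xi> \<simeq> And \<phi> \<xi>'"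
      and below: "\<And>\<psi>'. \<psi>' \<in> \<Phi>' \<Longrightarrow> (\<psi>', \<xi>') \<in> prec' \<Longrightarrow>
        \<psi>' \<simeq> \<phi> \<or> (\<exists>\<psi>\<in>\<Phi>. And \<phi> \<psi> \<simeq> And \<phi> \<psi>' \<and> (\<psi>, \<xi>) \<in> prec)"
      by blast
    have "(holds v w' \<xi>' \<longrightarrow> holds v w \<xi>') \<or>
        (\<exists>\<psi>'\<in>\<Phi>'. (\<psi>', \<xi>') \<in> prec' \<and> holds v w \<psi>' \<and> \<not> holds v w' \<psi>')"
      using le \<xi>'(1) by simp
    then consider "holds v w' \<xi>' \<longrightarrow> holds v w \<xi>'"
      | \<psi>' where "\<psi>' \<in> \<Phi>'" "(\<psi>', \<xi>') \<in> prec'" "holds v w \<psi>'" "\<not> holds v w' \<psi>'"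
      by blast
    then show ?thesis
    proof cases
      case 1
      then show ?thesis using w[THEN holds_cong_given[OF \<xi>'(2)]] by simp
    next
      case 2
      \<comment> \<open>The escape \<psi>' \<simeq> \<phi> is excluded because \<open>w'\<close>
        falsifies \<psi>' but satisfies \<phi>.\<close>
      then obtain \<psi> where \<psi>: "\<psi> \<in> \<Phi>" "And \<phi> \<psi> \<simeq> And \<phi> \<psi>'" "(\<psi>, \<xi>) \<in> prec"
        using below equiv by blast
      with 2 show ?thesis using w[THEN holds_cong_given[OF \<psi>(2)]] by blast
    qed
  qed
  \<comment> \<open>Here \<open>le\<close> supplies only that both worlds lie in
    \<open>W\<close>.\<close>
  with le show ?thesis by simp
qed

theorem proposition11:
  fixes P :: "'p set" and dag :: "'p transformation"
  assumes "countable P"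
    and "pgraph_transformation P dag"
    and "relevant TYPE('w) P dag"
    and "\<And>\<Phi> prec \<phi> \<Phi>' prec'.
      (\<Phi>, prec) \<in> pgraphs P \<Longrightarrow> \<phi> \<in> formulas P \<Longrightarrow> dag (\<Phi>, prec) \<phi> = (\<Phi>', prec') \<Longrightarrow>
      \<forall>\<xi>\<in>\<Phi>. \<exists>\<xi>'\<in>\<Phi>'. And \<phi> \<xi> \<simeq> And \<phi> \<xi>' \<and>
        (\<forall>\<psi>'\<in>\<Phi>'. (\<psi>', \<xi>') \<in> prec' \<longrightarrow>
          \<psi>' \<simeq> \<phi> \<or> (\<exists>\<psi>\<in>\<Phi>. And \<phi> \<psi> \<simeq> And \<phi> \<psi>' \<and> (\<psi>, \<xi>) \<in> prec))"
    and "\<And>\<Phi> prec \<phi> \<Phi>' prec'.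
      (\<Phi>, prec) \<in> pgraphs P \<Longrightarrow> \<phi> \<in> formulas P \<Longrightarrow> dag (\<Phi>, prec) \<phi> = (\<Phi>', prec') \<Longrightarrow>
      \<forall>\<xi>\<in>\<Phi>'. \<xi> \<simeq> \<phi> \<or> (\<exists>\<xi>'\<in>\<Phi>. And \<phi> \<xi> \<simeq> And \<phi> \<xi>' \<and>
        (\<forall>\<psi>'\<in>\<Phi>. (\<psi>', \<xi>') \<in> prec \<longrightarrow>
          (\<exists>\<psi>\<in>\<Phi>'. And \<phi> \<psi> \<simeq> And \<phi> \<psi>' \<and> (\<psi>, \<xi>) \<in> prec')))"
  shows "satisfies P dag (DP1_on P (graph_models P) :: ('p, 'w) operator \<Rightarrow> bool)"
proof -
  have "DP1_on P (graph_models P) star"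
    if star: "operator_induced_by P star dag" for star :: "('p, 'w) operator"
    unfolding DP1_on_def
  proof (intro allI impI ballI, elim conjE)
    fix W le v \<phi> le' w w'
    assume M: "(W, le, v) \<in> graph_models P" and \<phi>: "\<phi> \<in> formulas P"
      and le': "star (W, le, v) \<phi> = (W, le', v)" and w: "holds v w \<phi>" "holds v w' \<phi>"
    \<comment> \<open>A graph inducing the model is what links \<open>star\<close> to
      \<open>dag\<close>: both orders then become graph orders over the same \<open>W\<close> and
      \<open>v\<close>.\<close>
    from M obtain G where "G \<in> pgraphs P" "induced_by (W, le, v) G"
      and pref: "(W, le, v) \<in> pref_models P"
      unfolding graph_models_def by blast
    moreover obtain \<Phi> prec where "G = (\<Phi>, prec)"
      by fastforce
    ultimately have G: "(\<Phi>, prec) \<in> pgraphs P" and le: "induced_by (W, le, v) (\<Phi>, prec)"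
      by (simp_all only:)
    with pref have "induced_by (W, le', v) (dag (\<Phi>, prec) \<phi>)"
      using star \<phi> le' unfolding operator_induced_by_def by metis
    moreover obtain \<Phi>' prec' where G': "dag (\<Phi>, prec) \<phi> = (\<Phi>', prec')"
      by fastforce
    ultimately have "le' = graph_order (\<Phi>', prec') W v"
      by (simp del: graph_order.simps)
    moreover have "le = graph_order (\<Phi>, prec) W v"
      using le by (simp del: graph_order.simps)
    \<comment> \<open>The second condition carries the old order into the new one: in the transfer
      lemma the transformed graph takes the role of \<Phi> and the original one that of
      \<Phi>'.\<close>
    moreover have "(w, w') \<in> graph_order (\<Phi>', prec') W v"
      if "(w, w') \<in> graph_order (\<Phi>, prec) W v"
      by (rule graph_order_transfer[OF w _ that]) (use assms(5)[OF G \<phi> G'] in blast)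
    \<comment> \<open>Conversely, the first condition carries the new order back into the old
      one.\<close>
    moreover have "(w, w') \<in> graph_order (\<Phi>, prec) W v"
      if "(w, w') \<in> graph_order (\<Phi>', prec') W v"
      by (rule graph_order_transfer[OF w _ that]) (use assms(4)[OF G \<phi> G'] in blast)
    ultimately show "(w, w') \<in> le' \<longleftrightarrow> (w, w') \<in> le"
      by blast
  qed
  with assms(3) show ?thesis
    unfolding satisfies_def by blast
qed

end
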